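(* Let $q\in(-1,1)$ and let $F_H(y|q)=\int_{-2/\sqrt{1-q}}^{y}f_H(x|q)\,dx$ be the distribution function of the $q$-Gaussian distribution. Then for all real $y$ with $|y|\le 2/\sqrt{1-q}$, $$F_{H}(y|q)=\frac{1}{2}+\frac{1}{\pi}\arcsin\!\left(\frac{y\sqrt{1-q}}{2}\right)+\frac{1}{2\pi}\sqrt{4-(1-q)y^{2}}\,\sum_{k=1}^{\infty}(-1)^{k-1}q^{\binom{k}{2}}\left(1+q^{k}\right)\frac{U_{2k-1}\!\left(y\sqrt{1-q}/2\right)}{2k}.$$
   Context: For $q\in(-1,1)$ the $q$-Gaussian distribution has density $$f_{H}(x|q)=\frac{\sqrt{1-q}}{2\pi\sqrt{4-(1-q)x^{2}}}\prod_{k=0}^{\infty}\left((1+q^{k})^{2}-(1-q)x^{2}q^{k}\right)\prod_{k=0}^{\infty}(1-q^{k+1})$$ on $|x|\leq 2/\sqrt{1-q}$ (with value $0$ at the endpoints, by continuous extension), and $0$ elsewhere. The convention $q^{0}=1$ is used also for $q=0$. $U_n$ ($n\ge -1$) is the Chebyshev polynomial of the second kind, $U_n(\cos\theta)=\sin((n+1)\theta)/\sin\theta$. $\binom{k}{2}=k(k-1)/2$. *)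

theory Defs
  imports "HOL-Analysis.Analysis" "HOL-Computational_Algebra.Polynomial"
begin

definition chebyshev_U :: "int \<Rightarrow> real poly" where
  "chebyshev_U n =
     (THE p. \<forall>\<theta>. sin \<theta> \<noteq> 0 \<longrightarrow> poly p (cos \<theta>) = sin ((of_int n + 1) * \<theta>) / sin \<theta>)"

lemma chebyshev_U_ex1:
  "\<exists>!p :: real poly. \<forall>\<theta>. sin \<theta> \<noteq> 0 \<longrightarrow> poly p (cos \<theta>) = sin ((of_int n + 1) * \<theta>) / sin \<theta>"
proof -
  have nat_ex: "\<exists>p :: real poly. \<forall>\<theta>. sin \<theta> * poly p (cos \<theta>) = sin (real m * \<theta>)" for m
  proof (induction m rule: less_induct)
    case (less m)
    consider "m = 0" | "m = 1" | k where "m = Suc (Suc k)"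
      by (metis One_nat_def not0_implies_Suc)
    then show ?case
    proof cases
      case 1
      then show ?thesis by (intro exI[of _ 0]) simp
    next
      case 2
      then show ?thesis by (intro exI[of _ 1]) simp
    next
      case 3
      obtain p :: "real poly" where p: "\<And>\<theta>. sin \<theta> * poly p (cos \<theta>) = sin (real (Suc k) * \<theta>)"
        using less 3 by (metis lessI)
      obtain r :: "real poly" where r: "\<And>\<theta>. sin \<theta> * poly r (cos \<theta>) = sin (real k * \<theta>)"
        using less 3 by (metis less_Suc_eq)
      have "sin \<theta> * poly ([:0, 2:] * p - r) (cos \<theta>) = sin (real m * \<theta>)" for \<theta>
      proof -
        have "sin \<theta> * poly ([:0, 2:] * p - r) (cos \<theta>)
              = 2 * cos \<theta> * sin (real (Suc k) * \<theta>) - sin (real k * \<theta>)"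
          unfolding p[symmetric] r[symmetric] by (simp add: algebra_simps)
        also have "sin (real k * \<theta>) = sin (real (Suc k) * \<theta> - \<theta>)"
          by (simp add: algebra_simps)
        also have "2 * cos \<theta> * sin (real (Suc k) * \<theta>) - \<dots> = sin (real (Suc k) * \<theta> + \<theta>)"
          unfolding sin_add sin_diff by algebra
        also have "real (Suc k) * \<theta> + \<theta> = real m * \<theta>"
          using 3 by (simp add: algebra_simps)
        finally show ?thesis .
      qed
      then show ?thesis by blast
    qed
  qed
  have ex: "\<exists>p :: real poly. \<forall>\<theta>. sin \<theta> * poly p (cos \<theta>) = sin (of_int i * \<theta>)" for i
  proof (cases "i \<ge> 0")
    case True
    then show ?thesis using nat_ex[of "nat i"] by simp
  next
    case False
    obtain p :: "real poly" where p: "\<And>\<theta>. sin \<theta> * poly p (cos \<theta>) = sin (real (nat (-i)) * \<theta>)"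
      using nat_ex by blast
    have "sin \<theta> * poly (- p) (cos \<theta>) = sin (of_int i * \<theta>)" for \<theta>
      using p[of \<theta>] False by simp
    then show ?thesis by blast
  qed
  obtain p :: "real poly" where p: "\<And>\<theta>. sin \<theta> * poly p (cos \<theta>) = sin (of_int (n + 1) * \<theta>)"
    using ex by blast
  show ?thesis
  proof (intro ex1I allI impI)
    fix \<theta> :: real assume "sin \<theta> \<noteq> 0"
    then show "poly p (cos \<theta>) = sin ((of_int n + 1) * \<theta>) / sin \<theta>"
      using p[of \<theta>] by (simp add: field_simps)
  next
    fix r :: "real poly"
    assume r: "\<forall>\<theta>. sin \<theta> \<noteq> 0 \<longrightarrow> poly r (cos \<theta>) = sin ((of_int n + 1) * \<theta>) / sin \<theta>"
    have "{-1<..<1::real} \<subseteq> {x. poly (r - p) x = 0}"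
    proof
      fix x :: real assume "x \<in> {-1<..<1}"
      then have x: "cos (arccos x) = x" "sin (arccos x) \<noteq> 0"
        by (auto simp: sin_arccos_nonzero)
      then have "poly r x = sin ((of_int n + 1) * arccos x) / sin (arccos x)"
        using r by metis
      also have "\<dots> = poly p x"
        using p[of "arccos x"] x by (simp add: field_simps)
      finally show "x \<in> {x. poly (r - p) x = 0}" by simp
    qed
    moreover have "infinite {-1<..<1::real}" by (simp add: infinite_Ioo)
    ultimately have "infinite {x. poly (r - p) x = 0}" using finite_subset by blast
    then show "r = p" using poly_roots_finite[of "r - p"] by auto
  qed
qed

lemma chebyshev_U_cos:
  "sin \<theta> \<noteq> 0 \<Longrightarrow> poly (chebyshev_U n) (cos \<theta>) = sin ((of_int n + 1) * \<theta>) / sin \<theta>"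
  using theI'[OF chebyshev_U_ex1[of n]] unfolding chebyshev_U_def by blast

text \<open>The density is a quotient 0/0 at the endpoints of the support; it is set to 0 there, which is
  the continuous extension.\<close>

definition q_gaussian_density :: "real \<Rightarrow> real \<Rightarrow> real" where
  "q_gaussian_density q x =
     (if \<bar>x\<bar> < 2 / sqrt (1 - q)
      then sqrt (1 - q) / (2 * pi * sqrt (4 - (1 - q) * x\<^sup>2))
           * (\<Prod>k. (1 + q ^ k)\<^sup>2 - (1 - q) * x\<^sup>2 * q ^ k)
           * (\<Prod>k. 1 - q ^ (k + 1))
      else 0)"

lemma q_gaussian_convergent_prods:
  fixes q x :: real
  assumes "\<bar>q\<bar> < 1"
  shows "convergent_prod (\<lambda>k. (1 + q ^ k)\<^sup>2 - (1 - q) * x\<^sup>2 * q ^ k)"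
    and "convergent_prod (\<lambda>k. 1 - q ^ (k + 1))"
proof -
  have s: "summable (\<lambda>k. \<bar>q\<bar> ^ k)" using assms by (simp add: summable_geometric)
  define C where "C = 3 + \<bar>(1 - q) * x\<^sup>2\<bar>"
  have bound: "norm ((1 + q ^ k)\<^sup>2 - (1 - q) * x\<^sup>2 * q ^ k - 1) \<le> C * \<bar>q\<bar> ^ k" for k
  proof -
    have "\<bar>q ^ k\<bar> \<le> 1" using assms by (simp add: power_abs power_le_one)
    then have "\<bar>2 + q ^ k - (1 - q) * x\<^sup>2\<bar> \<le> C" unfolding C_def by linarith
    moreover have "(1 + q ^ k)\<^sup>2 - (1 - q) * x\<^sup>2 * q ^ k - 1
      = (2 + q ^ k - (1 - q) * x\<^sup>2) * q ^ k"
      by (simp add: power2_eq_square algebra_simps)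
    ultimately show ?thesis
      by (simp add: abs_mult power_abs mult_right_mono)
  qed
  have "summable (\<lambda>k. norm ((1 + q ^ k)\<^sup>2 - (1 - q) * x\<^sup>2 * q ^ k - 1))"
    by (rule summable_comparison_test'[OF summable_mult[OF s, of C], of 0])
      (use bound in simp)
  then show "convergent_prod (\<lambda>k. (1 + q ^ k)\<^sup>2 - (1 - q) * x\<^sup>2 * q ^ k)"
    by (intro abs_convergent_prod_imp_convergent_prod summable_imp_abs_convergent_prod)
  have "summable (\<lambda>k. norm ((1 - q ^ (k + 1)) - 1))"
    using summable_mult[OF s, of "\<bar>q\<bar>"] by (simp add: abs_mult power_abs)
  then show "convergent_prod (\<lambda>k. 1 - q ^ (k + 1))"
    by (intro abs_convergent_prod_imp_convergent_prod summable_imp_abs_convergent_prod)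
qed

definition q_gaussian_cdf :: "real \<Rightarrow> real \<Rightarrow> real" where
  "q_gaussian_cdf q y = (LINT x:{- 2 / sqrt (1 - q)..y}|lborel. q_gaussian_density q x)"

definition q_gaussian_series_term :: "real \<Rightarrow> real \<Rightarrow> nat \<Rightarrow> real" where
  "q_gaussian_series_term q y k =
     (-1) ^ (k - 1) * q ^ (k choose 2) * (1 + q ^ k)
     * (poly (chebyshev_U (2 * int k - 1)) (y * sqrt (1 - q) / 2) / (2 * real k))"

end

theory Submission
  imports Defs
begin

text \<open>
  Put \<open>x = 2 cos \<theta> / sqrt (1 - q)\<close>. The factors of the density become \<open>1 - 2 q^k cos 2\<theta> + q^(2k)\<close>, so
  by the Jacobi triple product the density is a multiple of
  \<open>\<Sum>k. (-1)^k q^(k(k+1)/2) sin ((2k+1)\<theta>)\<close>. Multiplication by the \<open>2 sin \<theta>\<close> from \<open>dx\<close> telescopes this into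
  a cosine series in \<open>2k\<theta>\<close>, which is integrated term by term. The triple product is obtained from a
  polynomial identity (the \<open>q\<close>-binomial theorem in symmetric form) by Tannery's theorem.
\<close>

section \<open>Finite form of the Jacobi triple product\<close>

definition qpoch :: "real \<Rightarrow> nat \<Rightarrow> real" where
  "qpoch q n = (\<Prod>i<n. 1 - q ^ Suc i)"

lemma qpoch_0 [simp]: "qpoch q 0 = 1"
  by (simp add: qpoch_def)

lemma qpoch_Suc: "qpoch q (Suc n) = qpoch q n * (1 - q ^ Suc n)"
  by (simp add: qpoch_def)

lemma one_minus_power_nonzero:
  fixes q :: real
  assumes "\<bar>q\<bar> < 1"
  shows "1 - q ^ Suc n \<noteq> 0"
proof -
  have "\<bar>q ^ Suc n\<bar> < 1"
    using assms by (simp add: power_abs power_less_one_iff del: power_Suc)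
  then show ?thesis by linarith
qed

lemma qpoch_nonzero: "\<bar>q\<bar> < 1 \<Longrightarrow> qpoch q n \<noteq> 0"
  using one_minus_power_nonzero by (force simp: qpoch_def)

lemma Suc_choose_two: "Suc n choose 2 = n + (n choose 2)"
  by (simp add: numeral_2_eq_2)

text \<open>Up to sign and power of \<open>q\<close>, the Gaussian binomial coefficient of \<open>2N+1\<close> over \<open>N-k\<close>.\<close>

definition theta_coeff :: "real \<Rightarrow> nat \<Rightarrow> nat \<Rightarrow> real" where
  "theta_coeff q N k =
     (if k \<le> N
      then (-1) ^ k * q ^ (Suc k choose 2) * (qpoch q (2 * N + 1) / (qpoch q (N - k) * qpoch q (N + k + 1)))
      else 0)"

text \<open>The ratio of neighbouring coefficients, cross-multiplied so that it survives at
  \<open>k = N\<close>: there the left side vanishes by the default value of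
  \<open>theta_coeff\<close>, the right side because of \<open>1 - q ^ 0\<close>.\<close>

lemma theta_coeff_Suc:
  assumes "\<bar>q\<bar> < 1" "k \<le> N"
  shows "theta_coeff q N (Suc k) * (1 - q ^ (N + k + 2)) = - (q ^ Suc k * (1 - q ^ (N - k)) * theta_coeff q N k)"
proof (cases "k = N")
  case True
  then show ?thesis by (simp add: theta_coeff_def)
next
  case False
  then obtain d where N: "N = Suc (k + d)"
    using assms(2) by (metis less_iff_Suc_add order_le_less)
  have e: "Suc (Suc k) choose 2 = Suc k + (Suc k choose 2)" by (rule Suc_choose_two)
  have s: "qpoch q (Suc d) = qpoch q d * (1 - q ^ Suc d)"
    "qpoch q (N + k + 2) = qpoch q (N + k + 1) * (1 - q ^ (N + k + 2))"
    by (simp_all add: qpoch_Suc)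
  have nz: "qpoch q d \<noteq> 0" "qpoch q (N + k + 1) \<noteq> 0" "1 - q ^ Suc d \<noteq> 0" "1 - q ^ (N + k + 2) \<noteq> 0"
    using qpoch_nonzero[OF assms(1)] one_minus_power_nonzero[OF assms(1), of "N + k + 1"]
      one_minus_power_nonzero[OF assms(1), of d] by simp_all
  have d: "N - k = Suc d" "N - Suc k = d" "N + Suc k + 1 = N + k + 2" "k \<le> N" "Suc k \<le> N" using N by auto
  show ?thesis
    unfolding theta_coeff_def d s e power_add[of q "Suc k"] using nz d
    by (simp add: divide_simps del: power_Suc add_2_eq_Suc') simp
qed

lemma power_double_Suc:
  fixes q :: real
  shows "q ^ (2 * N + 2) = (q ^ Suc N)\<^sup>2" "q ^ (2 * N + 3) = q * (q ^ Suc N)\<^sup>2"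
  by (simp_all add: power_even_eq numeral_3_eq_3 power2_eq_square)

text \<open>The ratio of the coefficients for \<open>Suc N\<close> and \<open>N\<close> at the same
  \<open>k\<close>: each Pochhammer symbol gains one or two factors. Those of the numerator are
  written in \<open>q ^ Suc N\<close>, the quantity in which the recurrences below are
  stated.\<close>

lemma theta_coeff_step:
  assumes "\<bar>q\<bar> < 1" "k \<le> N"
  shows "theta_coeff q (Suc N) k * ((1 - q ^ (Suc N - k)) * (1 - q ^ (N + k + 2)))
     = (1 - (q ^ Suc N)\<^sup>2) * (1 - q * (q ^ Suc N)\<^sup>2) * theta_coeff q N k"
proof -
  have s: "qpoch q (Suc N - k) = qpoch q (N - k) * (1 - q ^ (Suc N - k))"
    "qpoch q (N + k + 2) = qpoch q (N + k + 1) * (1 - q ^ (N + k + 2))"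
    "qpoch q (2 * N + 3) = qpoch q (2 * N + 1) * (1 - q ^ (2 * N + 2)) * (1 - q ^ (2 * N + 3))"
    using assms(2) by (simp_all add: qpoch_Suc Suc_diff_le numeral_3_eq_3)
  have nz: "qpoch q (N - k) \<noteq> 0" "qpoch q (N + k + 1) \<noteq> 0" "1 - q ^ (Suc N - k) \<noteq> 0" "1 - q ^ (N + k + 2) \<noteq> 0"
    using qpoch_nonzero[OF assms(1)] one_minus_power_nonzero[OF assms(1), of "N + k + 1"]
      one_minus_power_nonzero[OF assms(1), of "N - k"] assms(2) by (simp_all add: Suc_diff_le)
  have d: "k \<le> Suc N" "Suc N + k + 1 = N + k + 2" "2 * Suc N + 1 = 2 * N + 3" using assms by auto
  show ?thesis
    unfolding theta_coeff_def d s power_double_Suc using nz d assms(2)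
    by (simp add: divide_simps del: power_Suc)
qed

text \<open>Coefficient of sin \<theta> after a sine sum is multiplied by 1 - 2 Q cos 2\<theta> +
  Q^2 with Q = \<open>q ^ Suc N\<close>. Reflecting sin(-\<theta>) = -sin \<theta> puts
  \<open>- theta_coeff q N 0\<close> where index -1 would stand.\<close>

lemma theta_coeff_rec_0:
  assumes "\<bar>q\<bar> < 1"
  shows "theta_coeff q (Suc N) 0 =
    (1 + (q ^ Suc N)\<^sup>2) * theta_coeff q N 0 - q ^ Suc N * (theta_coeff q N 1 - theta_coeff q N 0)"
proof -
  define a where "a = theta_coeff q N 0"
  define b where "b = theta_coeff q N 1"
  define c where "c = theta_coeff q (Suc N) 0"
  define u where "u = q ^ N"
  have 1: "b * (1 - q\<^sup>2 * u) = - (q * (1 - u) * a)"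
    using theta_coeff_Suc[OF assms, of 0 N] by (simp add: a_def b_def u_def power2_eq_square mult_ac)
  have 2: "c * ((1 - q * u) * (1 - q\<^sup>2 * u)) = (1 - q\<^sup>2 * u\<^sup>2) * (1 - q ^ 3 * u\<^sup>2) * a"
    using theta_coeff_step[OF assms, of 0 N]
    by (simp add: a_def c_def u_def power2_eq_square power3_eq_cube mult_ac power_add power_mult_distrib)
  have nz: "1 - q * u \<noteq> 0" "1 - q\<^sup>2 * u \<noteq> 0"
    using one_minus_power_nonzero[OF assms, of N] one_minus_power_nonzero[OF assms, of "Suc N"]
    by (simp_all add: u_def power2_eq_square mult_ac)
  \<comment> \<open>Both denominators are cleared. Then \<open>1\<close> and \<open>2\<close>
    express \<open>b\<close> and \<open>c\<close> through \<open>a\<close>, and a polynomial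
    identity in \<open>q\<close> and \<open>u\<close> remains.\<close>
  have "((1 + q\<^sup>2 * u\<^sup>2) * a - q * u * (b - a)) * ((1 - q * u) * (1 - q\<^sup>2 * u))
     = ((1 + q\<^sup>2 * u\<^sup>2 + q * u) * a * (1 - q\<^sup>2 * u) - q * u * (b * (1 - q\<^sup>2 * u))) * (1 - q * u)"
    by (simp add: algebra_simps)
  also have "\<dots> = c * ((1 - q * u) * (1 - q\<^sup>2 * u))"
    unfolding 1 2 by (simp add: algebra_simps power2_eq_square power3_eq_cube)
  finally have "c = (1 + q\<^sup>2 * u\<^sup>2) * a - q * u * (b - a)"
    using nz by simp
  then show ?thesis
    by (simp add: a_def b_def c_def u_def power_add power_mult_distrib power2_eq_square mult_ac)
qed

text \<open>The same recurrence away from the reflection. Beyond the range all terms are 0; at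
  \<open>k = N\<close> only \<open>theta_coeff q N k\<close> survives on the right, and the
  triangular exponents match; below that the ratio lemmas apply.\<close>

lemma theta_coeff_rec_Suc:
  assumes "\<bar>q\<bar> < 1"
  shows "theta_coeff q (Suc N) (Suc k) =
    (1 + (q ^ Suc N)\<^sup>2) * theta_coeff q N (Suc k)
    - q ^ Suc N * (theta_coeff q N (Suc (Suc k)) + theta_coeff q N k)"
proof -
  consider "k > N" | "k = N" | d where "N = Suc (k + d)"
    by (metis less_iff_Suc_add linorder_neqE_nat)
  then show ?thesis
  proof cases
    case 1
    then show ?thesis by (simp add: theta_coeff_def)
  next
    case 2
    have "Suc (Suc k) choose 2 = Suc k + (Suc k choose 2)" by (rule Suc_choose_two)
    moreover have "qpoch q (2 * Suc k + 1) \<noteq> 0" "qpoch q (2 * k + 1) \<noteq> 0" by (rule qpoch_nonzero[OF assms])+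
    ultimately show ?thesis using 2 by (simp add: theta_coeff_def power_add mult_2)
  next
    case 3
    define a where "a = theta_coeff q N k"
    define b where "b = theta_coeff q N (Suc k)"
    define b' where "b' = theta_coeff q N (Suc (Suc k))"
    define c where "c = theta_coeff q (Suc N) (Suc k)"
    define u where "u = q ^ d"
    define v where "v = q ^ k"
    \<comment> \<open>With \<open>N = Suc (k + d)\<close> this is \<open>q ^ (N + k + 2)\<close>,
      the power in the ratio of neighbours.\<close>
    define w where "w = q ^ 3 * u * v\<^sup>2"
    have w: "q ^ (N + k + 2) = w" "q ^ (N + k + 3) = q * w" "q ^ N = q * u * v"
      by (simp_all add: 3 w_def u_def v_def power_add power2_eq_square power3_eq_cube mult_ac numeral_3_eq_3)
    have 1: "b * (1 - w) = - (q * v * (1 - q * u) * a)"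
      using theta_coeff_Suc[OF assms, of k N] w by (simp add: a_def b_def u_def v_def 3)
    have 2: "b' * (1 - q * w) = - (q\<^sup>2 * v * (1 - u) * b)"
      using theta_coeff_Suc[OF assms, of "Suc k" N] w
      by (simp add: b'_def b_def u_def v_def 3 power2_eq_square numeral_3_eq_3 mult_ac)
    have 3: "c * ((1 - q * u) * (1 - q * w)) = (1 - (q * (q * u * v))\<^sup>2) * (1 - q * (q * (q * u * v))\<^sup>2) * b"
      using theta_coeff_step[OF assms, of "Suc k" N] w unfolding w(3)[symmetric]
      by (simp add: b_def c_def u_def 3 power2_eq_square power_add power_mult_distrib numeral_3_eq_3 mult_ac)
    have nz: "1 - q * u \<noteq> 0" "1 - w \<noteq> 0" "1 - q * w \<noteq> 0"
      using one_minus_power_nonzero[OF assms, of d] one_minus_power_nonzero[OF assms, of "N + k + 1"]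
       one_minus_power_nonzero[OF assms, of "N + k + 2"] w
      by (simp_all add: u_def numeral_3_eq_3)
    \<comment> \<open>After clearing denominators, \<open>a\<close>, \<open>b'\<close> and
      \<open>c\<close> are all expressed through the middle coefficient \<open>b\<close>, which
      leaves a polynomial identity in \<open>q\<close>, \<open>u\<close>, \<open>v\<close>.\<close>
    have "((1 + (q * (q * u * v))\<^sup>2) * b - q * (q * u * v) * (b' + a)) * ((1 - q * u) * (1 - q * w))
     = ((1 + (q * (q * u * v))\<^sup>2) * b * (1 - q * u) - q * u * (q * v * (1 - q * u) * a)) * (1 - q * w)
       - q * (q * u * v) * (b' * (1 - q * w)) * (1 - q * u)"
      by (simp add: algebra_simps)
    also have "q * v * (1 - q * u) * a = - (b * (1 - w))"
      using 1 by simp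
    also have "((1 + (q * (q * u * v))\<^sup>2) * b * (1 - q * u) - q * u * (- (b * (1 - w)))) * (1 - q * w)
       - q * (q * u * v) * (b' * (1 - q * w)) * (1 - q * u) = c * ((1 - q * u) * (1 - q * w))"
      unfolding 2 3 by (simp add: algebra_simps power2_eq_square power3_eq_cube w_def)
    finally have "c = (1 + (q * (q * u * v))\<^sup>2) * b - q * (q * u * v) * (b' + a)"
      using nz by simp
    then show ?thesis
      unfolding w(3)[symmetric]
      by (simp add: a_def b_def b'_def c_def power_add power_mult_distrib power2_eq_square mult_ac)
  qed
qed

text \<open>Induction on the number of factors: multiplication by 2 cos 2\<theta> shifts the index
  of the sines by one in both directions, so a new factor changes the coefficients exactly by the
  recurrences above.\<close>

lemma finite_triple_product:
  fixes q \<theta> :: real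
  assumes "\<bar>q\<bar> < 1"
  shows "sin \<theta> * (\<Prod>k<N. 1 - 2 * q ^ Suc k * cos (2 * \<theta>) + q ^ (2 * Suc k))
    = (\<Sum>k\<le>N. theta_coeff q N k * sin (real (2 * k + 1) * \<theta>))"
proof (induction N)
  case 0
  then show ?case
    using one_minus_power_nonzero[OF assms, of 0] by (simp add: theta_coeff_def qpoch_def numeral_2_eq_2)
next
  case (Suc N)
  define s where "s k = sin (real (2 * k + 1) * \<theta>)" for k
  define A where "A = theta_coeff q N"
  define Q where "Q = q ^ Suc N"
  \<comment> \<open>Allows the upper limits \<open>N\<close> and \<open>Suc N\<close> to be
    exchanged in the index shifts below.\<close>
  have A0: "A k = 0" if "k > N" for k using that by (simp add: A_def theta_coeff_def)
  have s0: "2 * cos (2 * \<theta>) * s 0 = s 1 - s 0"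
  proof -
    have "s 1 = sin (2 * \<theta> + \<theta>)" "s 0 = sin (2 * \<theta> - \<theta>)" by (simp_all add: s_def)
    then show ?thesis unfolding sin_add sin_diff by (simp add: s_def algebra_simps)
  qed
  have sS: "2 * cos (2 * \<theta>) * s (Suc k) = s (Suc (Suc k)) + s k" for k
  proof -
    have "s (Suc (Suc k)) = sin (real (2 * Suc k + 1) * \<theta> + 2 * \<theta>)"
      "s k = sin (real (2 * Suc k + 1) * \<theta> - 2 * \<theta>)"
      by (simp_all add: s_def algebra_simps)
    then show ?thesis unfolding sin_add sin_diff by (simp add: s_def)
  qed
  have shift: "2 * cos (2 * \<theta>) * (\<Sum>k\<le>N. A k * s k)
     = (\<Sum>k\<le>N. A k * s (Suc k)) + (\<Sum>k\<le>N. A (Suc k) * s k) - A 0 * s 0"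
  proof -
    have "(\<Sum>k\<le>N. A k * s k) = (\<Sum>k\<le>Suc N. A k * s k)" using A0 by simp
    also have "\<dots> = A 0 * s 0 + (\<Sum>k\<le>N. A (Suc k) * s (Suc k))" by (rule sum.atMost_Suc_shift)
    finally have "2 * cos (2 * \<theta>) * (\<Sum>k\<le>N. A k * s k)
      = A 0 * (2 * cos (2 * \<theta>) * s 0) + (\<Sum>k\<le>N. A (Suc k) * (2 * cos (2 * \<theta>) * s (Suc k)))"
      by (simp add: algebra_simps sum_distrib_left)
    also have "\<dots> = A 0 * s 1 + (\<Sum>k\<le>N. A (Suc k) * s (Suc (Suc k))) + (\<Sum>k\<le>N. A (Suc k) * s k) - A 0 * s 0"
      unfolding s0 sS by (simp add: algebra_simps sum.distrib)
    also have "A 0 * s 1 + (\<Sum>k\<le>N. A (Suc k) * s (Suc (Suc k))) = (\<Sum>k\<le>Suc N. A k * s (Suc k))"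
      by (simp only: sum.atMost_Suc_shift[of "\<lambda>k. A k * s (Suc k)"] One_nat_def)
    also have "\<dots> = (\<Sum>k\<le>N. A k * s (Suc k))" using A0 by simp
    finally show ?thesis .
  qed
  have "(\<Sum>k\<le>Suc N. theta_coeff q (Suc N) k * s k)
     = ((1 + Q\<^sup>2) * A 0 - Q * (A 1 - A 0)) * s 0
       + (\<Sum>k\<le>N. ((1 + Q\<^sup>2) * A (Suc k) - Q * (A (Suc (Suc k)) + A k)) * s (Suc k))"
    unfolding sum.atMost_Suc_shift theta_coeff_rec_0[OF assms] theta_coeff_rec_Suc[OF assms]
    by (simp add: A_def Q_def)
  also have "\<dots> = (1 + Q\<^sup>2) * (A 0 * s 0 + (\<Sum>k\<le>N. A (Suc k) * s (Suc k)))
     - Q * (A 1 * s 0 + (\<Sum>k\<le>N. A (Suc (Suc k)) * s (Suc k)) + (\<Sum>k\<le>N. A k * s (Suc k)) - A 0 * s 0)"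
    by (simp add: algebra_simps sum.distrib sum_subtractf sum_distrib_left)
  also have "A 0 * s 0 + (\<Sum>k\<le>N. A (Suc k) * s (Suc k)) = (\<Sum>k\<le>N. A k * s k)"
    unfolding sum.atMost_Suc_shift[of "\<lambda>k. A k * s k", symmetric] using A0 by simp
  also have "A 1 * s 0 + (\<Sum>k\<le>N. A (Suc (Suc k)) * s (Suc k)) = (\<Sum>k\<le>N. A (Suc k) * s k)"
    using sum.atMost_Suc_shift[of "\<lambda>k. A (Suc k) * s k" N] A0 by simp
  also have "(1 + Q\<^sup>2) * (\<Sum>k\<le>N. A k * s k)
      - Q * ((\<Sum>k\<le>N. A (Suc k) * s k) + (\<Sum>k\<le>N. A k * s (Suc k)) - A 0 * s 0)
      = (1 - 2 * Q * cos (2 * \<theta>) + Q\<^sup>2) * (\<Sum>k\<le>N. A k * s k)"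
    using shift by algebra
  also have "(\<Sum>k\<le>N. A k * s k) = sin \<theta> * (\<Prod>k<N. 1 - 2 * q ^ Suc k * cos (2 * \<theta>) + q ^ (2 * Suc k))"
    using Suc by (simp add: A_def s_def)
  also have "Q\<^sup>2 = q ^ (2 * Suc N)" using power_double_Suc(1)[of q N] by (simp add: Q_def)
  finally show ?case
    by (simp add: s_def Q_def mult_ac)
qed

section \<open>Passage to the infinite product, and the density as a theta series\<close>

lemma qpoch_LIMSEQ:
  assumes "\<bar>q\<bar> < 1"
  shows "qpoch q \<longlonglongrightarrow> (\<Prod>k. 1 - q ^ (k + 1))"
  using convergent_prod_LIMSEQ[OF q_gaussian_convergent_prods(2)[OF assms]]
  unfolding qpoch_def Suc_eq_plus1 by (rule LIMSEQ_lessThan_iff_atMost[THEN iffD2])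

lemma prodinf_qpoch_nonzero:
  fixes q :: real
  assumes "\<bar>q\<bar> < 1"
  shows "(\<Prod>k. 1 - q ^ (k + 1)) \<noteq> 0"
  using prodinf_nonzero[OF q_gaussian_convergent_prods(2)[OF assms]] one_minus_power_nonzero[OF assms]
  by simp

text \<open>The exponent k(k+1)/2 is at least k. This geometric majorant serves all convergence
  arguments below.\<close>

lemma abs_power_choose_two_le:
  fixes q :: real
  assumes "\<bar>q\<bar> < 1"
  shows "\<bar>q ^ (Suc k choose 2)\<bar> \<le> \<bar>q\<bar> ^ k"
  unfolding power_abs using assms by (intro power_decreasing) (simp_all add: Suc_choose_two)

text \<open>All three Pochhammer symbols have the same nonzero limit L, so their quotient tends to L
  / (L * L) = 1 / L.\<close>

lemma theta_coeff_LIMSEQ: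
  assumes "\<bar>q\<bar> < 1"
  shows "(\<lambda>N. theta_coeff q N k) \<longlonglongrightarrow> (-1) ^ k * q ^ (Suc k choose 2) / (\<Prod>k. 1 - q ^ (k + 1))"
proof -
  define L where "L = (\<Prod>k. 1 - q ^ (k + 1))"
  have L: "qpoch q \<longlonglongrightarrow> L" "L \<noteq> 0"
    using qpoch_LIMSEQ[OF assms] prodinf_qpoch_nonzero[OF assms] by (simp_all add: L_def)
  have 1: "(\<lambda>N. qpoch q (2 * N + 1)) \<longlonglongrightarrow> L"
    by (rule filterlim_compose[OF L(1) filterlim_subseq]) (simp add: strict_mono_def)
  have 2: "(\<lambda>N. qpoch q (N - k)) \<longlonglongrightarrow> L"
    by (rule filterlim_compose[OF L(1) filterlim_minus_const_nat_at_top])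
  have 3: "(\<lambda>N. qpoch q (N + k + 1)) \<longlonglongrightarrow> L"
    by (rule filterlim_compose[OF L(1) filterlim_subseq]) (simp add: strict_mono_def)
  have "(\<lambda>N. (-1) ^ k * q ^ (Suc k choose 2) * (qpoch q (2 * N + 1) / (qpoch q (N - k) * qpoch q (N + k + 1))))
     \<longlonglongrightarrow> (-1) ^ k * q ^ (Suc k choose 2) * (L / (L * L))"
    using L(2) by (intro tendsto_intros 1 2 3) simp
  moreover have "\<forall>\<^sub>F N in sequentially. theta_coeff q N k =
      (-1) ^ k * q ^ (Suc k choose 2) * (qpoch q (2 * N + 1) / (qpoch q (N - k) * qpoch q (N + k + 1)))"
    using eventually_ge_at_top[of k] by eventually_elim (simp add: theta_coeff_def)
  ultimately have "(\<lambda>N. theta_coeff q N k) \<longlonglongrightarrow> (-1) ^ k * q ^ (Suc k choose 2) * (L / (L * L))"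
    by (rule Lim_transform_eventually[OF _ eventually_mono]) simp
  then show ?thesis using L(2) by (simp add: L_def)
qed

text \<open>The majorant for Tannery's theorem must be uniform in \<open>N\<close>. It is, since
  \<open>qpoch q\<close> converges to a nonzero limit, so that both it and its reciprocal are
  bounded.\<close>

lemma theta_coeff_bound:
  assumes "\<bar>q\<bar> < 1"
  shows "\<exists>C. \<forall>N k. \<bar>theta_coeff q N k\<bar> \<le> C * \<bar>q\<bar> ^ k"
proof -
  have "Bseq (qpoch q)" "Bseq (\<lambda>n. inverse (qpoch q n))"
    using qpoch_LIMSEQ[OF assms] tendsto_inverse[OF qpoch_LIMSEQ[OF assms] prodinf_qpoch_nonzero[OF assms]]
    by (auto intro: convergent_imp_Bseq convergentI)
  then obtain K M where K: "K > 0" "\<And>n. \<bar>qpoch q n\<bar> \<le> K" and M: "M > 0" "\<And>n. inverse \<bar>qpoch q n\<bar> \<le> M"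
    by (auto simp: Bseq_def)
  have "\<bar>theta_coeff q N k\<bar> \<le> K * (M * M) * \<bar>q\<bar> ^ k" for N k
  proof (cases "k \<le> N")
    case True
    then have "\<bar>theta_coeff q N k\<bar> = \<bar>qpoch q (2 * N + 1)\<bar>
        * (inverse \<bar>qpoch q (N - k)\<bar> * inverse \<bar>qpoch q (N + k + 1)\<bar>) * \<bar>q ^ (Suc k choose 2)\<bar>"
      by (simp add: theta_coeff_def abs_mult power_abs divide_inverse)
    also have "\<dots> \<le> K * (M * M) * \<bar>q\<bar> ^ k"
      using K M abs_power_choose_two_le[OF assms] by (intro mult_mono) (auto intro: less_imp_le)
    finally show ?thesis .
  next
    case False
    then show ?thesis using K M by (simp add: theta_coeff_def)
  qed
  then show ?thesis by blast
qed

text \<open>For q > 0 this is Jacobi's theta_1 with nome q^(1/2), divided by 2 q^(1/8).\<close>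

definition theta_series :: "real \<Rightarrow> real \<Rightarrow> real" where
  "theta_series q \<theta> = (\<Sum>k. (-1) ^ k * q ^ (Suc k choose 2) * sin (real (2 * k + 1) * \<theta>))"

lemma triple_product_LIMSEQ:
  fixes q \<theta> :: real
  assumes "\<bar>q\<bar> < 1"
  shows "(\<lambda>N. sin \<theta> * (\<Prod>k<N. 1 - 2 * q ^ Suc k * cos (2 * \<theta>) + q ^ (2 * Suc k)))
    \<longlonglongrightarrow> theta_series q \<theta> / (\<Prod>k. 1 - q ^ (k + 1))"
proof -
  define L where "L = (\<Prod>k. 1 - q ^ (k + 1))"
  define s where "s k = sin (real (2 * k + 1) * \<theta>)" for k
  obtain C where C: "\<And>N k. \<bar>theta_coeff q N k\<bar> \<le> C * \<bar>q\<bar> ^ k"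
    using theta_coeff_bound[OF assms] by blast
  have sC: "summable (\<lambda>k. C * \<bar>q\<bar> ^ k)"
    using assms by (intro summable_mult summable_geometric) simp
  have bound: "norm (theta_coeff q N k * s k) \<le> C * \<bar>q\<bar> ^ k" for N k
  proof -
    have "\<bar>theta_coeff q N k\<bar> * \<bar>s k\<bar> \<le> \<bar>theta_coeff q N k\<bar> * 1"
      by (intro mult_left_mono) (simp_all add: s_def)
    then show ?thesis using C[of N k] by (simp add: abs_mult)
  qed
  have lim: "(\<lambda>N. theta_coeff q N k * s k) \<longlonglongrightarrow> (-1) ^ k * q ^ (Suc k choose 2) / L * s k" for k
    unfolding L_def by (intro tendsto_intros theta_coeff_LIMSEQ assms)
  have T: "summable (\<lambda>k. norm ((-1) ^ k * q ^ (Suc k choose 2) / L * s k))"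
      "(\<lambda>N. \<Sum>k. theta_coeff q N k * s k) \<longlonglongrightarrow> (\<Sum>k. (-1) ^ k * q ^ (Suc k choose 2) / L * s k)"
    using tannerys_theorem[of "\<lambda>k N. theta_coeff q N k * s k", OF lim _ sC] bound
    by (auto intro: always_eventually)
  \<comment> \<open>The default value 0 for \<open>k > N\<close> makes the finite sum a series, the
    form Tannery's theorem speaks of.\<close>
  have "(\<Sum>k. theta_coeff q N k * s k) = (\<Sum>k\<le>N. theta_coeff q N k * s k)" for N
    by (rule suminf_finite) (simp_all add: theta_coeff_def)
  moreover have "(\<Sum>k. (-1) ^ k * q ^ (Suc k choose 2) / L * s k) = theta_series q \<theta> / L"
  proof -
    have "summable (\<lambda>k. L * ((-1) ^ k * q ^ (Suc k choose 2) / L * s k))"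
      by (rule summable_mult[OF summable_norm_cancel[OF T(1)]])
    then have "summable (\<lambda>k. (-1) ^ k * q ^ (Suc k choose 2) * s k)"
      using prodinf_qpoch_nonzero[OF assms] by (simp add: L_def mult.assoc)
    from suminf_divide[OF this, of L] show ?thesis
      by (simp add: theta_series_def s_def)
  qed
  ultimately show ?thesis
    using T(2) unfolding finite_triple_product[OF assms] by (simp add: s_def L_def)
qed

text \<open>The factor for k = 0 is 4 sin^2 \<theta>. One sine completes the triple product, the
  other cancels against the root 2 sin \<theta>, and the product of the
  \<open>1 - q ^ (k + 1)\<close> cancels the denominator of the triple product.\<close>

lemma q_gaussian_density_eq_theta_series:
  assumes "\<bar>q\<bar> < 1" "0 \<le> \<theta>" "\<theta> \<le> pi"
  shows "q_gaussian_density q (2 * cos \<theta> / sqrt (1 - q)) = sqrt (1 - q) / pi * theta_series q \<theta>"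
proof (cases "sin \<theta> = 0")
  case True
  then have \<theta>: "\<theta> = 0 \<or> \<theta> = pi"
    using assms sin_gt_zero[of \<theta>] by fastforce
  \<comment> \<open>At the endpoints the density is 0 by definition, and every sine in the series
    vanishes.\<close>
  have "sin (real (2 * k + 1) * pi) = 0" for k
    by (simp only: sin_npi)
  then have "theta_series q \<theta> = 0"
    using \<theta> by (auto simp: theta_series_def simp del: of_nat_Suc of_nat_add of_nat_mult)
  then show ?thesis
    using \<theta> assms(1) by (auto simp: q_gaussian_density_def)
next
  case False
  define a where "a = sqrt (1 - q)"
  define x where "x = 2 * cos \<theta> / a"
  define L where "L = (\<Prod>k. 1 - q ^ (k + 1))"
  have a: "a > 0" "a\<^sup>2 = 1 - q" using assms(1) by (auto simp: a_def)
  have ax: "(1 - q) * x\<^sup>2 = 4 * (cos \<theta>)\<^sup>2"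
    using a by (simp add: x_def power_divide power_mult_distrib flip: a(2))
  have sin: "sin \<theta> > 0" using False sin_ge_zero[OF assms(2,3)] by simp
  have root: "sqrt (4 - (1 - q) * x\<^sup>2) = 2 * sin \<theta>"
  proof -
    have "4 - (1 - q) * x\<^sup>2 = (2 * sin \<theta>)\<^sup>2"
      unfolding ax power_mult_distrib sin_squared_eq by simp
    then show ?thesis using sin by (metis real_sqrt_unique mult_nonneg_nonneg less_imp_le zero_le_numeral)
  qed
  have "(cos \<theta>)\<^sup>2 < 1" using sin by (simp add: cos_squared_eq)
  then have "\<bar>cos \<theta>\<bar> < 1" by (simp add: abs_square_less_1)
  then have dom: "\<bar>x\<bar> < 2 / sqrt (1 - q)"
    using a(1) by (simp add: x_def abs_mult a_def[symmetric] divide_simps)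
  have fac: "(1 + q ^ k)\<^sup>2 - (1 - q) * x\<^sup>2 * q ^ k = 1 - 2 * q ^ k * cos (2 * \<theta>) + q ^ (2 * k)" for k
    unfolding ax cos_double_cos by (simp add: power2_eq_square power_mult power_mult_distrib algebra_simps)
  have fac0: "1 - 2 * q ^ 0 * cos (2 * \<theta>) + q ^ (2 * 0) = 4 * sin \<theta> * sin \<theta>"
    by (simp add: cos_double_sin power2_eq_square)
  have "(\<lambda>N. 4 * sin \<theta> * (sin \<theta> * (\<Prod>k<N. 1 - 2 * q ^ Suc k * cos (2 * \<theta>) + q ^ (2 * Suc k))))
      \<longlonglongrightarrow> 4 * sin \<theta> * (theta_series q \<theta> / L)"
    unfolding L_def by (intro tendsto_intros triple_product_LIMSEQ assms(1))
  also have "(\<lambda>N. 4 * sin \<theta> * (sin \<theta> * (\<Prod>k<N. 1 - 2 * q ^ Suc k * cos (2 * \<theta>) + q ^ (2 * Suc k))))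
      = (\<lambda>N. \<Prod>k\<le>N. (1 + q ^ k)\<^sup>2 - (1 - q) * x\<^sup>2 * q ^ k)"
    unfolding prod.atMost_shift fac fac0 by (simp only: mult.assoc)
  finally have "(\<Prod>k. (1 + q ^ k)\<^sup>2 - (1 - q) * x\<^sup>2 * q ^ k) = 4 * sin \<theta> * (theta_series q \<theta> / L)"
    by (rule LIMSEQ_unique[OF convergent_prod_LIMSEQ[OF q_gaussian_convergent_prods(1)[OF assms(1)]]])
  then have "q_gaussian_density q x = a / (2 * pi * (2 * sin \<theta>)) * (4 * sin \<theta> * (theta_series q \<theta> / L)) * L"
    using dom root by (simp add: q_gaussian_density_def a_def L_def)
  also have "\<dots> = a / pi * theta_series q \<theta>"
    using sin prodinf_qpoch_nonzero[OF assms(1)] by (simp add: L_def)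
  finally show ?thesis by (simp add: x_def a_def)
qed

section \<open>Cosine expansion and integration of the density\<close>

lemma summable_theta_terms:
  fixes q :: real and s :: "nat \<Rightarrow> real"
  assumes "\<bar>q\<bar> < 1" "\<And>k. \<bar>s k\<bar> \<le> 1"
  shows "summable (\<lambda>k. (-1) ^ k * q ^ (Suc k choose 2) * s k)"
proof (rule summable_comparison_test')
  show "summable (\<lambda>k. \<bar>q\<bar> ^ k)" using assms(1) by (simp add: summable_geometric)
  show "norm ((-1) ^ k * q ^ (Suc k choose 2) * s k) \<le> \<bar>q\<bar> ^ k" for k
    using mult_mono[OF abs_power_choose_two_le[OF assms(1), of k] assms(2)[of k]]
    by (simp add: abs_mult)
qed

text \<open>Makes the density continuous up to the endpoints of its support, hence integrable
  there.\<close>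

lemma continuous_on_theta_series:
  assumes "\<bar>q\<bar> < 1"
  shows "continuous_on A (theta_series q)"
proof -
  have "uniform_limit A (\<lambda>n \<theta>. \<Sum>k<n. (-1) ^ k * q ^ (Suc k choose 2) * sin (real (2 * k + 1) * \<theta>))
      (theta_series q) sequentially"
    unfolding theta_series_def
  proof (rule Weierstrass_m_test)
    show "summable (\<lambda>k. \<bar>q\<bar> ^ k)" using assms by (simp add: summable_geometric)
    show "norm ((-1) ^ k * q ^ (Suc k choose 2) * sin (real (2 * k + 1) * \<theta>)) \<le> \<bar>q\<bar> ^ k" for k \<theta>
      using mult_mono[OF abs_power_choose_two_le[OF assms, of k] abs_sin_le_one[of "real (2 * k + 1) * \<theta>"]]
      by (simp add: abs_mult)
  qed
  then show ?thesis
    by (rule uniform_limit_theorem[rotated]) (auto intro!: always_eventually continuous_intros)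
qed

text \<open>The difference of the theta coefficients at \<open>n\<close> and \<open>Suc n\<close>;
  also the coefficient of the asserted series at \<open>k = Suc n\<close>.\<close>

definition cosine_coeff :: "real \<Rightarrow> nat \<Rightarrow> real" where
  "cosine_coeff q n = (-1) ^ n * q ^ (Suc n choose 2) * (1 + q ^ Suc n)"

lemma abs_cosine_coeff_le:
  assumes "\<bar>q\<bar> < 1"
  shows "\<bar>cosine_coeff q n\<bar> \<le> 2 * \<bar>q\<bar> ^ n"
proof -
  have "\<bar>q ^ Suc n\<bar> \<le> 1" using assms unfolding power_abs by (intro power_le_one) auto
  then have "\<bar>1 + q ^ Suc n\<bar> \<le> 2" by linarith
  from mult_mono[OF abs_power_choose_two_le[OF assms, of n] this] show ?thesis
    by (simp add: cosine_coeff_def abs_mult mult.commute)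
qed

lemma summable_cosine_coeff_bound: "\<bar>q\<bar> < 1 \<Longrightarrow> summable (\<lambda>n. 2 * \<bar>q\<bar> ^ n)" for q :: real
  by (intro summable_mult summable_geometric) simp

lemma summable_cosine_coeff:
  assumes "\<bar>q\<bar> < 1" "\<And>n. \<bar>s n\<bar> \<le> 1"
  shows "summable (\<lambda>n. cosine_coeff q n * s n)"
proof (rule summable_comparison_test'[OF summable_cosine_coeff_bound[OF assms(1)]])
  show "norm (cosine_coeff q n * s n) \<le> 2 * \<bar>q\<bar> ^ n" for n
    using mult_mono[OF abs_cosine_coeff_le[OF assms(1), of n] assms(2)[of n]]
    by (simp add: abs_mult)
qed

text \<open>Summation by parts: 2 sin \<theta> sin((2k+1)\<theta>) = cos 2k\<theta> - cos
  (2k+2)\<theta>, and the difference is moved onto the coefficients. The boundary term is the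
  constant 1.\<close>

lemma sin_mult_theta_series:
  assumes "\<bar>q\<bar> < 1"
  shows "2 * sin \<theta> * theta_series q \<theta> = 1 - (\<Sum>n. cosine_coeff q n * cos (2 * real (Suc n) * \<theta>))"
proof -
  define t where "t k = (-1) ^ k * q ^ (Suc k choose 2)" for k
  define c where "c k = cos (2 * real k * \<theta>)" for k
  have sm: "summable (\<lambda>k. t k * s k)" if "\<And>k. \<bar>s k\<bar> \<le> 1" for s
    unfolding t_def using assms that by (rule summable_theta_terms)
  have s0: "summable (\<lambda>k. t k * c k)" and s1: "summable (\<lambda>k. t k * c (Suc k))"
    by (rule sm, simp add: c_def)+
  have s2: "summable (\<lambda>k. t (Suc k) * c (Suc k))"
    using s0 by (subst summable_Suc_iff)
  have "2 * sin \<theta> * theta_series q \<theta> = (\<Sum>k. 2 * sin \<theta> * (t k * sin (real (2 * k + 1) * \<theta>)))"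
    unfolding theta_series_def t_def[symmetric] by (rule suminf_mult[symmetric], rule sm) simp
  also have "\<dots> = (\<Sum>k. t k * c k - t k * c (Suc k))"
  proof (rule suminf_cong)
    fix k
    have "c k = cos (real (2 * k + 1) * \<theta> - \<theta>)" "c (Suc k) = cos (real (2 * k + 1) * \<theta> + \<theta>)"
      by (simp_all add: c_def algebra_simps)
    then have "c k - c (Suc k) = 2 * sin \<theta> * sin (real (2 * k + 1) * \<theta>)"
      unfolding cos_add cos_diff by simp
    then show "2 * sin \<theta> * (t k * sin (real (2 * k + 1) * \<theta>)) = t k * c k - t k * c (Suc k)"
      by algebra
  qed
  also have "\<dots> = (\<Sum>k. t k * c k) - (\<Sum>k. t k * c (Suc k))"
    by (rule suminf_diff[symmetric, OF s0 s1])
  also have "(\<Sum>k. t k * c k) = 1 + (\<Sum>k. t (Suc k) * c (Suc k))"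
    using suminf_split_head[OF s0] by (simp add: t_def c_def numeral_2_eq_2)
  also have "1 + (\<Sum>k. t (Suc k) * c (Suc k)) - (\<Sum>k. t k * c (Suc k))
      = 1 - (\<Sum>k. t k * c (Suc k) - t (Suc k) * c (Suc k))"
    using suminf_diff[OF s1 s2] by simp
  also have "(\<lambda>k. t k * c (Suc k) - t (Suc k) * c (Suc k)) = (\<lambda>n. cosine_coeff q n * cos (2 * real (Suc n) * \<theta>))"
    by (simp add: fun_eq_iff t_def c_def cosine_coeff_def Suc_choose_two[of "Suc _"] power_add algebra_simps)
  finally show ?thesis .
qed

text \<open>Under \<open>y = 2 cos \<theta> / sqrt (1 - q)\<close> this is the asserted value of the distribution function.\<close>

definition cdf_angle :: "real \<Rightarrow> real \<Rightarrow> real" where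
  "cdf_angle q \<theta> = 1 - \<theta> / pi
     + 1 / pi * (\<Sum>n. cosine_coeff q n * (sin (2 * real (Suc n) * \<theta>) / (2 * real (Suc n))))"

text \<open>Term by term differentiation, by uniform convergence of the differentiated series. The
  sign is negative because the abscissa decreases in \<theta>; the derivative of arccos will
  compensate it.\<close>

lemma cdf_angle_deriv:
  assumes "\<bar>q\<bar> < 1"
  shows "(cdf_angle q has_real_derivative - (2 / pi * sin \<theta> * theta_series q \<theta>)) (at \<theta>)"
proof -
  have "((\<lambda>\<theta>. \<Sum>n. cosine_coeff q n * (sin (2 * real (Suc n) * \<theta>) / (2 * real (Suc n)))) has_real_derivative
      (\<Sum>n. cosine_coeff q n * cos (2 * real (Suc n) * \<theta>))) (at \<theta>)"
  \<comment> \<open>At the base point 0 all sines vanish, so convergence there is trivial.\<close>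
  proof (rule has_field_derivative_series'(2)[where S = UNIV and ?x0.0 = 0])
    show "((\<lambda>\<theta>. cosine_coeff q n * (sin (2 * real (Suc n) * \<theta>) / (2 * real (Suc n)))) has_real_derivative
        cosine_coeff q n * cos (2 * real (Suc n) * x)) (at x within UNIV)" for n x
      by (auto intro!: derivative_eq_intros simp: field_simps simp del: of_nat_Suc)
    show "uniformly_convergent_on UNIV (\<lambda>n \<theta>. \<Sum>i<n. cosine_coeff q i * cos (2 * real (Suc i) * \<theta>))"
    proof (rule Weierstrass_m_test'[OF _ summable_cosine_coeff_bound[OF assms]])
      show "norm (cosine_coeff q n * cos (2 * real (Suc n) * x)) \<le> 2 * \<bar>q\<bar> ^ n" for n x
        using mult_mono[OF abs_cosine_coeff_le[OF assms, of n] abs_cos_le_one[of "2 * real (Suc n) * x"]]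
        by (simp add: abs_mult)
    qed
  qed simp_all
  then have "(cdf_angle q has_real_derivative
      0 - 1 / pi + 1 / pi * (\<Sum>n. cosine_coeff q n * cos (2 * real (Suc n) * \<theta>))) (at \<theta>)"
    unfolding cdf_angle_def by (intro DERIV_add DERIV_diff DERIV_const DERIV_cdivide DERIV_ident DERIV_cmult)
  also have "0 - 1 / pi + 1 / pi * (\<Sum>n. cosine_coeff q n * cos (2 * real (Suc n) * \<theta>))
     = - (1 / pi * (1 - (\<Sum>n. cosine_coeff q n * cos (2 * real (Suc n) * \<theta>))))"
    by (simp add: algebra_simps)
  also have "\<dots> = - (2 / pi * sin \<theta> * theta_series q \<theta>)"
    unfolding sin_mult_theta_series[OF assms, symmetric] by simp
  finally show ?thesis .
qed

text \<open>The angle pi belongs to the left end of the support; the constant 1 in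
  \<open>cdf_angle\<close> is chosen to give the value 0 there.\<close>

lemma cdf_angle_pi: "cdf_angle q pi = 0"
proof -
  have "sin (2 * real (Suc n) * pi) = 0" for n
    using sin_npi[of "2 * Suc n"] by simp
  then show ?thesis by (simp add: cdf_angle_def del: of_nat_Suc)
qed

lemma q_gaussian_cdf_eq_cdf_angle:
  assumes "\<bar>q\<bar> < 1" "\<bar>y\<bar> \<le> 2 / sqrt (1 - q)"
  shows "q_gaussian_cdf q y = cdf_angle q (arccos (y * sqrt (1 - q) / 2))"
proof -
  define a where "a = sqrt (1 - q)"
  have a: "a > 0" using assms(1) by (simp add: a_def)
  define G where "G x = cdf_angle q (arccos (x * a / 2))" for x
  have y: "- 2 / a \<le> y" "y \<le> 2 / a" using assms(2) by (auto simp: a_def)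
  have range: "-1 \<le> x * a / 2 \<and> x * a / 2 \<le> 1" if "x \<in> {- 2 / a..y}" for x
  proof -
    have "- 2 / a \<le> x" "x \<le> 2 / a" using that y by auto
    then show ?thesis using a by (simp add: field_simps)
  qed
  have dens: "q_gaussian_density q x = a / pi * theta_series q (arccos (x * a / 2))" if "x \<in> {- 2 / a..y}" for x
    using q_gaussian_density_eq_theta_series[OF assms(1), of "arccos (x * a / 2)"] range[OF that] a
    by (simp add: arccos_lbound arccos_ubound cos_arccos a_def[symmetric])
  have cont: "continuous_on {- 2 / a..y} (q_gaussian_density q)"
  proof -
    have "continuous_on {- 2 / a..y} (\<lambda>x. a / pi * theta_series q (arccos (x * a / 2)))"
      using range
      by (intro continuous_on_mult continuous_on_const continuous_intros
          continuous_on_compose2[OF continuous_on_theta_series[OF assms(1), of UNIV] continuous_on_arccos]) auto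
    then show ?thesis by (rule continuous_on_eq) (simp add: dens)
  qed
  have contG: "continuous_on {- 2 / a..y} G"
  proof -
    have c: "continuous_on UNIV (cdf_angle q)"
      by (rule DERIV_continuous_on) (rule cdf_angle_deriv[OF assms(1), THEN has_field_derivative_at_within])
    have "continuous_on {- 2 / a..y} (\<lambda>x. arccos (x * a / 2))"
      using range a by (intro continuous_on_arccos continuous_intros) auto
    from continuous_on_compose2[OF c this] show ?thesis
      by (simp add: G_def)
  qed
  have "(q_gaussian_density q has_integral (G y - G (- 2 / a))) {- 2 / a..y}"
  \<comment> \<open>arccos is not differentiable at -1 and 1, so derivatives are taken in the
    interior only and \<open>G\<close> is continuous on the closed interval.\<close>
  proof (rule fundamental_theorem_of_calculus_interior[OF y(1) contG])
    fix x assume x: "x \<in> {- 2 / a<..<y}"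
    define z where "z = x * a / 2"
    have "- 2 / a < x" "x < 2 / a" using x y by auto
    then have z: "-1 < z" "z < 1" using a by (simp_all add: z_def field_simps)
    have sz: "sin (arccos z) = sqrt (1 - z\<^sup>2)" "sqrt (1 - z\<^sup>2) \<noteq> 0"
      using z sin_arccos_nonzero[of z] by (simp_all add: sin_arccos)
    have "((\<lambda>x. x * a / 2) has_real_derivative a / 2) (at x)"
      by (auto intro!: derivative_eq_intros)
    from DERIV_chain2[OF DERIV_arccos[OF z, unfolded z_def] this]
    have "((\<lambda>x. arccos (x * a / 2)) has_real_derivative inverse (- sqrt (1 - z\<^sup>2)) * (a / 2)) (at x)"
      by (simp only: z_def)
    from DERIV_chain2[OF cdf_angle_deriv[OF assms(1)] this]
    have "(G has_real_derivative - (2 / pi * sin (arccos z) * theta_series q (arccos z))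
        * (inverse (- sqrt (1 - z\<^sup>2)) * (a / 2))) (at x)"
      by (simp only: G_def[abs_def] z_def)
    \<comment> \<open>The sine coming from \<open>cdf_angle\<close> cancels the root in the
      derivative of arccos.\<close>
    also have "- (2 / pi * sin (arccos z) * theta_series q (arccos z)) * (inverse (- sqrt (1 - z\<^sup>2)) * (a / 2))
        = a / pi * theta_series q (arccos z)"
      using sz by (simp add: field_simps)
    also have "\<dots> = q_gaussian_density q x"
      using dens[of x] x by (simp add: z_def)
    finally show "(G has_vector_derivative q_gaussian_density q x) (at x)"
      by (simp add: has_real_derivative_iff_has_vector_derivative)
  qed
  moreover have "G (- 2 / a) = 0" using a by (simp add: G_def cdf_angle_pi)
  \<comment> \<open>Continuity of the density identifies the Lebesgue integral with the gauge
    integral of the fundamental theorem.\<close>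
  moreover have "q_gaussian_cdf q y = integral {- 2 / a..y} (q_gaussian_density q)"
    unfolding q_gaussian_cdf_def a_def[symmetric]
    by (rule set_borel_integral_eq_integral(2)[OF borel_integrable_atLeastAtMost'[OF cont]])
  ultimately show ?thesis
    by (simp add: integral_unique G_def a_def)
qed

section \<open>Chebyshev polynomials of odd index and the final formula\<close>

lemma sin_mult_chebyshev_U:
  assumes "0 \<le> \<theta>" "\<theta> \<le> pi"
  shows "sin \<theta> * poly (chebyshev_U (2 * int k - 1)) (cos \<theta>) = sin (2 * real k * \<theta>)"
proof (cases "sin \<theta> = 0")
  case True
  \<comment> \<open>The quotient formula for U is silent here, but the product form holds as both
    sides are 0.\<close>
  then have "\<theta> = 0 \<or> \<theta> = pi"
    using assms sin_gt_zero[of \<theta>] by fastforce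
  then show ?thesis
    using sin_npi[of "2 * k"] by auto
next
  case False
  then show ?thesis by (simp add: chebyshev_U_cos)
qed

lemma abs_sin_of_nat_mult_le: "\<bar>sin (real n * x)\<bar> \<le> real n * \<bar>sin x\<bar>"
proof (induction n)
  case (Suc n)
  have "\<bar>sin (real (Suc n) * x)\<bar> = \<bar>sin (real n * x) * cos x + cos (real n * x) * sin x\<bar>"
    using sin_add[of "real n * x" x] by (simp add: distrib_right add.commute)
  also have "\<dots> \<le> \<bar>sin (real n * x)\<bar> * \<bar>cos x\<bar> + \<bar>cos (real n * x)\<bar> * \<bar>sin x\<bar>"
    by (metis abs_mult abs_triangle_ineq)
  also have "\<dots> \<le> \<bar>sin (real n * x)\<bar> * 1 + 1 * \<bar>sin x\<bar>"
    by (intro add_mono mult_mono) auto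
  finally show ?case using Suc by (simp add: algebra_simps)
qed simp

lemma abs_chebyshev_U_odd_le:
  assumes "\<bar>x\<bar> \<le> 1"
  shows "\<bar>poly (chebyshev_U (2 * int k - 1)) x\<bar> \<le> 2 * real k"
proof -
  let ?p = "poly (chebyshev_U (2 * int k - 1))"
  have "\<bar>?p x\<bar> \<le> 2 * real k" if "x \<in> {-1<..<1}" for x
  proof -
    have s: "sin (arccos x) \<noteq> 0" "cos (arccos x) = x" using that by (auto simp: sin_arccos_nonzero)
    have "\<bar>?p x\<bar> = \<bar>sin (real (2 * k) * arccos x)\<bar> / \<bar>sin (arccos x)\<bar>"
      using chebyshev_U_cos[OF s(1), of "2 * int k - 1"] s(2) by (simp add: abs_divide)
    also have "\<dots> \<le> real (2 * k)"
      using abs_sin_of_nat_mult_le[of "2 * k" "arccos x"] s(1) by (simp add: divide_le_eq)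
    finally show ?thesis by simp
  qed
  then have "{-1<..<1} \<subseteq> {x. \<bar>?p x\<bar> \<le> 2 * real k}" by blast
  moreover have "closed {x. \<bar>?p x\<bar> \<le> 2 * real k}"
    by (intro closed_Collect_le continuous_intros)
  ultimately have "closure {-1<..<1} \<subseteq> {x. \<bar>?p x\<bar> \<le> 2 * real k}" by (rule closure_minimal)
  then show ?thesis using assms by (auto simp: abs_le_iff)
qed

theorem corollary1:
  fixes q y :: real
  assumes "q \<in> {-1<..<1}"
    and "\<bar>y\<bar> \<le> 2 / sqrt (1 - q)"
  shows "summable (\<lambda>n. q_gaussian_series_term q y (Suc n)) \<and>
    q_gaussian_cdf q y =
      1 / 2 + 1 / pi * arcsin (y * sqrt (1 - q) / 2)
      + 1 / (2 * pi) * sqrt (4 - (1 - q) * y\<^sup>2)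
        * (\<Sum>n. q_gaussian_series_term q y (Suc n))"
proof
  have q: "\<bar>q\<bar> < 1" using assms(1) by auto
  define z where "z = y * sqrt (1 - q) / 2"
  define \<theta> where "\<theta> = arccos z"
  define U where "U n = poly (chebyshev_U (2 * int (Suc n) - 1)) z" for n
  have "\<bar>y\<bar> * sqrt (1 - q) \<le> 2"
    using assms by (simp add: pos_le_divide_eq)
  then have z: "\<bar>z\<bar> \<le> 1" using q by (simp add: z_def abs_mult)
  then have \<theta>: "0 \<le> \<theta>" "\<theta> \<le> pi" "cos \<theta> = z"
    by (auto simp: \<theta>_def arccos_lbound arccos_ubound cos_arccos_abs)
  have series_term: "q_gaussian_series_term q y (Suc n) = cosine_coeff q n * (U n / (2 * real (Suc n)))" for n
    by (simp add: q_gaussian_series_term_def cosine_coeff_def U_def z_def)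
  \<comment> \<open>The denominator exactly absorbs the growth of U, so summability follows from
    that of \<open>cosine_coeff\<close>, also at the endpoints.\<close>
  have "\<bar>U n / (2 * real (Suc n))\<bar> \<le> 1" for n
    using abs_chebyshev_U_odd_le[OF z, of "Suc n"] by (simp add: U_def abs_divide)
  then show sm: "summable (\<lambda>n. q_gaussian_series_term q y (Suc n))"
    unfolding series_term by (rule summable_cosine_coeff[OF q])
  have root: "sqrt (4 - (1 - q) * y\<^sup>2) = 2 * sin \<theta>"
  proof -
    have "4 - (1 - q) * y\<^sup>2 = 4 * (1 - z\<^sup>2)"
      using q by (simp add: z_def power_divide power_mult_distrib)
    also have "\<dots> = (2 * sin \<theta>)\<^sup>2"
      by (simp add: power_mult_distrib sin_squared_eq \<theta>(3))
    finally show ?thesis using sin_ge_zero[OF \<theta>(1,2)] by (simp add: real_sqrt_mult)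
  qed
  have "1 / (2 * pi) * sqrt (4 - (1 - q) * y\<^sup>2) * (\<Sum>n. q_gaussian_series_term q y (Suc n))
      = 1 / pi * (sin \<theta> * (\<Sum>n. q_gaussian_series_term q y (Suc n)))"
    unfolding root by simp
  also have "sin \<theta> * (\<Sum>n. q_gaussian_series_term q y (Suc n))
      = (\<Sum>n. sin \<theta> * q_gaussian_series_term q y (Suc n))"
    by (rule suminf_mult[OF sm, symmetric])
  \<comment> \<open>The sine supplied by the root turns each Chebyshev value into the sine of a
    multiple angle, which gives the series in \<open>cdf_angle\<close>.\<close>
  also have "\<dots> = (\<Sum>n. cosine_coeff q n * (sin (2 * real (Suc n) * \<theta>) / (2 * real (Suc n))))"
    unfolding series_term U_def sin_mult_chebyshev_U[OF \<theta>(1,2), symmetric] \<theta>(3) by (simp add: mult_ac)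
  finally have "cdf_angle q \<theta> = 1 - \<theta> / pi
     + 1 / (2 * pi) * sqrt (4 - (1 - q) * y\<^sup>2) * (\<Sum>n. q_gaussian_series_term q y (Suc n))"
    by (simp add: cdf_angle_def)
  moreover have "1 - \<theta> / pi = 1 / 2 + 1 / pi * arcsin z"
    using z by (simp add: \<theta>_def arccos_arcsin_eq diff_divide_distrib)
  moreover have "q_gaussian_cdf q y = cdf_angle q \<theta>"
    using q_gaussian_cdf_eq_cdf_angle[OF q assms(2)] by (simp add: \<theta>_def z_def)
  ultimately show "q_gaussian_cdf q y = 1 / 2 + 1 / pi * arcsin (y * sqrt (1 - q) / 2)
      + 1 / (2 * pi) * sqrt (4 - (1 - q) * y\<^sup>2) * (\<Sum>n. q_gaussian_series_term q y (Suc n))"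
    by (simp add: z_def)
qed

end
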